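(* Let $\{X_n\}_{n=-\infty}^{\infty}$ be a stationary real-valued time series. Assume that $\{\mathcal{P}_k\}$ is a nested sequence of finite partitions of the real line by intervals, and let $\zeta_k$ be the stopping times built from $\{X_n\}$, $\{\mathcal{P}_k\}$ and the block lengths $\{l_k\}$ as described in the context. If for some $\epsilon>0$ $$\sum_{k=1}^\infty (k+1)2^{-l_k\epsilon}<\infty,$$ then $$\zeta_k<|\mathcal{P}_k|^{l_k}\,2^{l_k\epsilon}$$ eventually almost surely, i.e. almost surely the inequality holds for all sufficiently large $k$.
   Context: Notation: $X_m^n=(X_m,\dots,X_n)$ for $m\le n$; $|\mathcal{P}_k|$ is the number of cells of $\mathcal{P}_k$. Partitions: $\{\mathcal{P}_k\}_{k=0}^\infty$ is nested, meaning each $\mathcal{P}_{k+1}$ refines $\mathcal{P}_k$. For $x\in\mathbb{R}$, $[x]^k$ denotes the unique interval of $\mathcal{P}_k$ containing $x$. For $C\subseteq\mathbb{R}$, $\mathrm{diam}(C)=\sup_{y,z\in C}|z-y|$. It is a standing assumption that $\lim_{k\to\infty}\mathrm{diam}([x]^k)=0$ for all $x\in\mathbb{R}$. Write $[X_m^n]^k=([X_m]^k,\dots,[X_n]^k)$. Block lengths: $\{l_k\}_{k\ge1}$ is a nondecreasing sequence of positive integers with $1\le l_k\le k$ and $\lim_{k\to\infty}l_k=\infty$. Stopping times: $\zeta_0=0$ and, for $k\ge1$, $$\eta_k=\min\{t>0:\ [X_{\zeta_{k-1}-(l_k-1)+t}^{\zeta_{k-1}+t}]^k=[X_{\zeta_{k-1}-(l_k-1)}^{\zeta_{k-1}}]^k\},\qquad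 \zeta_k=\zeta_{k-1}+\eta_k,$$ where $t$ ranges over positive integers (with $\min\emptyset=\infty$). *)

theory Defs
  imports "HOL-Probability.Probability"
begin

definition (in prob_space) stationary_process :: "(int \<Rightarrow> 'a \<Rightarrow> real) \<Rightarrow> bool" where
  "stationary_process X \<longleftrightarrow>
     (\<forall>n. random_variable borel (X n)) \<and>
     (\<forall>J s. finite J \<longrightarrow>
        distr M (\<Pi>\<^sub>M i\<in>J. borel) (\<lambda>\<omega>. \<lambda>i\<in>J. X (i + s) \<omega>) =
        distr M (\<Pi>\<^sub>M i\<in>J. borel) (\<lambda>\<omega>. \<lambda>i\<in>J. X i \<omega>))"

definition finite_interval_partition :: "real set set \<Rightarrow> bool" where
  "finite_interval_partition Q \<longleftrightarrow>
     finite Q \<and> partition_on UNIV Q \<and> (\<forall>C\<in>Q. is_interval C)"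

definition cell :: "real set set \<Rightarrow> real \<Rightarrow> real set" where
  "cell Q x = (THE C. C \<in> Q \<and> x \<in> C)"

text \<open>The diameter takes values in the extended reals, because a finite partition of the line has
  unbounded cells, for which the real-valued library constant \<open>diameter\<close> is unspecified.\<close>

definition ediam :: "real set \<Rightarrow> ereal" where
  "ediam C = (SUP (y, z)\<in>C \<times> C. ereal \<bar>z - y\<bar>)"

text \<open>The functions below take a single sample path \<open>x\<close>.\<close>

definition quantized_block :: "real set set \<Rightarrow> (int \<Rightarrow> real) \<Rightarrow> int \<Rightarrow> int \<Rightarrow> real set list" where
  "quantized_block Q x m n = map (\<lambda>i. cell Q (x i)) [m..n]"

text \<open>Waiting time, from position \<open>z\<close>, until the quantized block of length \<open>L\<close> ending at \<open>z\<close>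
  recurs; it is \<open>\<infinity>\<close>, the infimum of the empty set, if the block never recurs.\<close>

definition recurrence_time :: "real set set \<Rightarrow> nat \<Rightarrow> (int \<Rightarrow> real) \<Rightarrow> int \<Rightarrow> enat" where
  "recurrence_time Q L x z =
     Inf {enat t | t. t > 0 \<and>
       quantized_block Q x (z - (int L - 1) + int t) (z + int t) =
       quantized_block Q x (z - (int L - 1)) z}"

primrec zeta :: "(nat \<Rightarrow> real set set) \<Rightarrow> (nat \<Rightarrow> nat) \<Rightarrow> (int \<Rightarrow> real) \<Rightarrow> nat \<Rightarrow> enat" where
  "zeta P l x 0 = 0"
| "zeta P l x (Suc k) =
     (case zeta P l x k of
        enat z \<Rightarrow> enat z + recurrence_time (P (Suc k)) (l (Suc k)) x (int z)
      | \<infinity> \<Rightarrow> \<infinity>)"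

end

theory Submission
  imports Defs
begin

text \<open>
  Seen from path space, the stopping time \<open>\<zeta>\<^sub>k\<close> is built from return times. For a level \<open>k\<close>, classify
  a path by the quantized block of length \<open>l\<^sub>k\<close> that ends at time 0; there are at most
  \<open>|P\<^sub>k|^l\<^sub>k\<close> classes. Let \<open>r\<^sub>k\<close> be the first positive shift that brings a path back into its own
  class, and let \<open>T\<^sub>k\<close> be the map that shifts a path by \<open>r\<^sub>k\<close>. Then
  \<open>\<zeta>\<^sub>k = r\<^sub>1 + r\<^sub>2 \<circ> T\<^sub>1 + \<dots> + r\<^sub>k \<circ> T\<^sub>k\<^sub>-\<^sub>1 \<circ> \<dots> \<circ> T\<^sub>1\<close>.
  Two facts about a stationary law control this sum, and both come from looking at the same event
  backwards in time.

  First, Kac's inequality: \<open>r\<^sub>k\<close> has expectation at most the number of classes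
  (\<open>nn_integral_return_time_le\<close>). By stationarity, the probability of \<open>r\<^sub>k > t\<close> is that of the event
  that the class visited at time \<open>-t\<close> has not been visited again up to time 0. On a given path this
  happens for at most one \<open>t\<close> per class, so the sum over \<open>t\<close> is at most the number of classes.

  Second, \<open>T\<^sub>k\<close> does not increase the integral of a nonnegative function
  (\<open>nn_integral_at_return_time_le\<close>). After a shift by \<open>-t\<close>, the event \<open>r\<^sub>k = t\<close> says that the most
  recent earlier visit to the present class was at time \<open>-t\<close>, so these shifted events are disjoint.

  Together they give that \<open>\<zeta>\<^sub>k\<close> has expectation at most the sum of \<open>|P\<^sub>j|^l\<^sub>j\<close> over
  \<open>1 \<le> j \<le> k\<close>, hence at most \<open>k |P\<^sub>k|^l\<^sub>k\<close>, as the partitions are nested and the block lengths do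
  not decrease. Markov's inequality bounds the probability that \<open>\<zeta>\<^sub>k\<close> reaches
  \<open>|P\<^sub>k|^l\<^sub>k 2 powr (l\<^sub>k \<epsilon>)\<close> by \<open>k 2 powr (- l\<^sub>k \<epsilon>)\<close>, which is summable, and the Borel-Cantelli lemma
  concludes. The expectations count infinite values, so finiteness of \<open>\<zeta>\<^sub>k\<close> almost surely, that is
  Poincare recurrence, is part of the same estimate.
\<close>

section \<open>Return times in a measure-preserving system\<close>

text \<open>The backward-in-time arguments below bound, for each path, a number of times by a number of
  classes; this lemma is the counting step.\<close>

lemma suminf_indicator_le_card:
  assumes "finite K" and "f ` T \<subseteq> K" and "inj_on f (T :: nat set)"
  shows "(\<Sum>t. indicator T t :: ennreal) \<le> of_nat (card K)"
proof -
  have fin: "finite T" using assms by (meson finite_imageD finite_subset)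
  then have "(\<Sum>t. indicator T t :: ennreal) = (\<Sum>t\<in>T. indicator T t)"
    by (rule suminf_finite) auto
  also have "\<dots> = of_nat (card T)" by simp
  also have "\<dots> \<le> of_nat (card K)"
    using card_inj_on_le[OF assms(3,2,1)] by (intro of_nat_mono)
  finally show ?thesis .
qed

locale measure_preserving_action = prob_space N for N :: "'b measure" +
  fixes S :: "int \<Rightarrow> 'b \<Rightarrow> 'b"
  assumes S_0: "S 0 x = x"
    and S_add: "S m (S n x) = S (m + n) x"
    and measurable_S [measurable]: "S n \<in> N \<rightarrow>\<^sub>M N"
    and distr_S: "distr N N (S n) = N"
begin

lemma nn_integral_S:
  assumes [measurable]: "f \<in> borel_measurable N"
  shows "(\<integral>\<^sup>+x. f (S n x) \<partial>N) = (\<integral>\<^sup>+x. f x \<partial>N)"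
  by (subst (2) distr_S[of n, symmetric]) (simp add: nn_integral_distr)

definition return_time :: "('b \<Rightarrow> 'c) \<Rightarrow> 'b \<Rightarrow> enat" where
  "return_time c x = Inf {enat t | t. t > 0 \<and> c (S (int t) x) = c x}"

lemma less_return_time_iff:
  "enat t < return_time c x \<longleftrightarrow> (\<forall>i. 0 < i \<and> i \<le> t \<longrightarrow> c (S (int i) x) \<noteq> c x)"
proof -
  have "enat t < return_time c x \<longleftrightarrow> \<not> return_time c x < enat (Suc t)"
    by (cases "return_time c x") auto
  also have "return_time c x < enat (Suc t) \<longleftrightarrow>
      (\<exists>i. 0 < i \<and> i \<le> t \<and> c (S (int i) x) = c x)"
    unfolding return_time_def Inf_less_iff by (auto simp: less_Suc_eq_le)
  finally show ?thesis by blast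
qed

lemma return_time_eq_iff:
  "return_time c x = enat t \<longleftrightarrow>
     0 < t \<and> c (S (int t) x) = c x \<and> (\<forall>i. 0 < i \<and> i < t \<longrightarrow> c (S (int i) x) \<noteq> c x)"
proof -
  have "return_time c x = enat t \<longleftrightarrow>
      \<not> enat t < return_time c x \<and> (\<forall>s<t. enat s < return_time c x)"
    by (cases "return_time c x") (auto simp: not_less intro: le_antisym leI)
  also have "\<dots> \<longleftrightarrow>
      (\<exists>i. 0 < i \<and> i \<le> t \<and> c (S (int i) x) = c x) \<and> (\<forall>i. 0 < i \<and> i < t \<longrightarrow> c (S (int i) x) \<noteq> c x)"
    unfolding less_return_time_iff by (auto intro: le_less_trans)
  also have "\<dots> \<longleftrightarrow>
     0 < t \<and> c (S (int t) x) = c x \<and> (\<forall>i. 0 < i \<and> i < t \<longrightarrow> c (S (int i) x) \<noteq> c x)"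
    by (metis le_neq_implies_less less_or_eq_imp_le)
  finally show ?thesis .
qed

lemma pred_same_class:
  assumes "finite K" and K: "\<And>x. x \<in> space N \<Longrightarrow> c x \<in> K"
    and [measurable]: "\<And>a. Measurable.pred N (\<lambda>x. c x = a)"
  shows "Measurable.pred N (\<lambda>x. c (S n x) = c x)"
proof -
  have [measurable]: "Measurable.pred N (\<lambda>x. c (S n x) = a)" for a
    by (rule measurable_compose[OF measurable_S]) measurable
  have "Measurable.pred N (\<lambda>x. \<exists>a\<in>K. c (S n x) = a \<and> c x = a)"
    using countable_finite[OF \<open>finite K\<close>] by measurable
  also have "?this \<longleftrightarrow> ?thesis"
    by (rule measurable_cong) (use K in auto)
  finally show ?thesis .
qed

lemma measurable_return_time:
  assumes "finite K" and "\<And>x. x \<in> space N \<Longrightarrow> c x \<in> K"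
    and "\<And>a. Measurable.pred N (\<lambda>x. c x = a)"
  shows "return_time c \<in> N \<rightarrow>\<^sub>M count_space UNIV"
proof -
  note [measurable] = pred_same_class[OF assms]
  have "return_time c x =
      (INF t. if t > 0 \<and> c (S (int t) x) = c x then enat t else \<infinity>)" (is "_ = (INF t. ?h t)") for x
  proof (rule antisym)
    show "return_time c x \<le> (INF t. ?h t)"
      unfolding return_time_def by (intro INF_greatest) (auto intro: Inf_lower)
    show "(INF t. ?h t) \<le> return_time c x"
      unfolding return_time_def
    proof (rule Inf_greatest)
      fix z assume "z \<in> {enat t | t. t > 0 \<and> c (S (int t) x) = c x}"
      then obtain t where "z = enat t" "t > 0" "c (S (int t) x) = c x" by blast
      then have z: "z = ?h t" by simp
      show "(INF t. ?h t) \<le> z" unfolding z by (rule INF_lower) simp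
    qed
  qed
  then have eq: "return_time c = (\<lambda>x. INF t. if t > 0 \<and> c (S (int t) x) = c x then enat t else \<infinity>)"
    by blast
  show ?thesis unfolding eq by measurable
qed

text \<open>Kac's inequality. Shifting by \<open>-t\<close> turns the event of no return within \<open>t\<close> steps into the event
  that the class seen at time \<open>-t\<close> is not seen again up to time 0. Two different \<open>t\<close> for
  which this happens on the same path must belong to different classes.\<close>

lemma nn_integral_return_time_le:
  assumes fin: "finite K" and K: "\<And>x. x \<in> space N \<Longrightarrow> c x \<in> K"
    and c: "\<And>a. Measurable.pred N (\<lambda>x. c x = a)"
  shows "(\<integral>\<^sup>+x. ennreal_of_enat (return_time c x) \<partial>N) \<le> of_nat (card K)"
proof -
  note [measurable] = measurable_return_time[OF assms]
  have "(\<integral>\<^sup>+x. ennreal_of_enat (return_time c x) \<partial>N)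
      = (\<Sum>t. emeasure N {x\<in>space N. enat t < return_time c x})"
    by (rule nn_integral_enat_function) measurable
  also have "\<dots> = (\<Sum>t. \<integral>\<^sup>+x. indicator {x\<in>space N. enat t < return_time c x} x \<partial>N)"
    by (intro suminf_cong nn_integral_indicator[symmetric]) measurable
  also have "\<dots> =
      (\<Sum>t. \<integral>\<^sup>+x. indicator {x\<in>space N. enat t < return_time c x} (S (- int t) x) \<partial>N)"
    by (intro suminf_cong nn_integral_S[symmetric]) measurable
  also have "\<dots> =
      (\<integral>\<^sup>+x. (\<Sum>t. indicator {x\<in>space N. enat t < return_time c x} (S (- int t) x)) \<partial>N)"
    by (rule nn_integral_suminf[symmetric]) measurable
  also have "\<dots> \<le> (\<integral>\<^sup>+x. of_nat (card K) \<partial>N)"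
  proof (rule nn_integral_mono)
    fix x assume x: "x \<in> space N"
    define T where "T = {t. enat t < return_time c (S (- int t) x)}"
    have S_space: "S n x \<in> space N" for n
      using measurable_space[OF measurable_S x] .
    have neq: "c (S (- int s) x) \<noteq> c (S (- int t) x)" if "s \<in> T" "t \<in> T" "s < t" for s t
    proof -
      have "c (S (int (t - s)) (S (- int t) x)) \<noteq> c (S (- int t) x)"
        using that unfolding T_def less_return_time_iff by (auto simp del: of_nat_diff)
      then show ?thesis using that by (simp add: S_add of_nat_diff)
    qed
    have "inj_on (\<lambda>t. c (S (- int t) x)) T"
      by (rule linorder_inj_onI) (use neq in auto)
    then have "(\<Sum>t. indicator T t :: ennreal) \<le> of_nat (card K)"
      using S_space K by (intro suminf_indicator_le_card[OF fin]) auto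
    then show "(\<Sum>t. indicator {x\<in>space N. enat t < return_time c x} (S (- int t) x) :: ennreal)
        \<le> of_nat (card K)"
      using S_space by (simp add: T_def indicator_def)
  qed
  also have "\<dots> = of_nat (card K)"
    by (simp add: emeasure_space_1)
  finally show ?thesis .
qed

text \<open>Functions are cut off to zero where the time is infinite, so that integrals along a sequence of
  return times are taken over the event that all of them are finite.\<close>

definition at_time :: "enat \<Rightarrow> ('b \<Rightarrow> ennreal) \<Rightarrow> 'b \<Rightarrow> ennreal" where
  "at_time \<tau> f x = (case \<tau> of enat n \<Rightarrow> f (S (int n) x) | \<infinity> \<Rightarrow> 0)"

lemma measurable_at_time [measurable (raw)]:
  assumes [measurable]: "\<tau> \<in> N \<rightarrow>\<^sub>M count_space UNIV" "f \<in> borel_measurable N"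
  shows "(\<lambda>x. at_time (\<tau> x) f x) \<in> borel_measurable N"
  unfolding at_time_def by measurable

lemma at_time_eq_suminf:
  "at_time \<tau> f x = (\<Sum>t. indicator {t. \<tau> = enat t} t * f (S (int t) x))"
proof (cases \<tau>)
  case (enat n)
  have "(\<Sum>t. indicator {t. \<tau> = enat t} t * f (S (int t) x))
      = (\<Sum>t\<in>{n}. indicator {t. \<tau> = enat t} t * f (S (int t) x))"
    using enat by (intro suminf_finite) auto
  then show ?thesis using enat by (simp add: at_time_def)
qed (simp add: at_time_def)

text \<open>Moving to the first return does not increase mass: seen from the point of arrival, the
  length of the step is the time since the most recent earlier visit to the same class, so each
  point is reached by at most one step length.\<close>

lemma nn_integral_at_return_time_le:
  assumes "finite K" and "\<And>x. x \<in> space N \<Longrightarrow> c x \<in> K"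
    and "\<And>a. Measurable.pred N (\<lambda>x. c x = a)"
    and f [measurable]: "f \<in> borel_measurable N"
  shows "(\<integral>\<^sup>+x. at_time (return_time c x) f x \<partial>N) \<le> (\<integral>\<^sup>+x. f x \<partial>N)"
proof -
  note [measurable] = measurable_return_time[OF assms(1-3)]
  define B where "B t = {x\<in>space N. return_time c x = enat t}" for t
  have [measurable]: "B t \<in> sets N" for t unfolding B_def by measurable
  have "(\<integral>\<^sup>+x. at_time (return_time c x) f x \<partial>N)
      = (\<integral>\<^sup>+x. (\<Sum>t. indicator (B t) x * f (S (int t) x)) \<partial>N)"
    by (intro nn_integral_cong) (simp add: at_time_eq_suminf B_def indicator_def)
  also have "\<dots> = (\<Sum>t. \<integral>\<^sup>+x. indicator (B t) x * f (S (int t) x) \<partial>N)"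
    by (rule nn_integral_suminf) measurable
  also have "\<dots> = (\<Sum>t. \<integral>\<^sup>+x. indicator (B t) (S (- int t) x) * f (S (int t) (S (- int t) x)) \<partial>N)"
    by (subst nn_integral_S[where f="\<lambda>x. indicator (B _) x * f (S (int _) x)"]) auto
  also have "\<dots> = (\<Sum>t. \<integral>\<^sup>+x. indicator (B t) (S (- int t) x) * f x \<partial>N)"
    by (simp add: S_add S_0)
  also have "\<dots> = (\<integral>\<^sup>+x. (\<Sum>t. indicator (B t) (S (- int t) x) * f x) \<partial>N)"
    by (rule nn_integral_suminf[symmetric]) measurable
  also have "\<dots> \<le> (\<integral>\<^sup>+x. f x \<partial>N)"
  proof (rule nn_integral_mono)
    fix x
    define T where "T = {t. S (- int t) x \<in> B t}"
    \<comment> \<open>If the last step had length \<open>t\<close>, a visit at the intermediate time \<open>-s\<close> would have ended it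
      earlier.\<close>
    have False if "s \<in> T" "t \<in> T" "s < t" for s t
    proof -
      have s: "c x = c (S (- int s) x)" and t: "c x = c (S (- int t) x)"
        and first: "\<forall>i. 0 < i \<and> i < t \<longrightarrow> c (S (int i) (S (- int t) x)) \<noteq> c (S (- int t) x)"
        using that(1,2) by (auto simp: T_def B_def return_time_eq_iff S_add S_0)
      have "0 < s" using that(1) by (simp add: T_def B_def return_time_eq_iff)
      then have "c (S (int (t - s)) (S (- int t) x)) \<noteq> c (S (- int t) x)"
        using first that(3) by (auto simp del: of_nat_diff)
      then show False using s t that(3) by (simp add: S_add of_nat_diff)
    qed
    \<comment> \<open>So \<open>T\<close> has at most one element.\<close>
    then have inj: "inj_on (\<lambda>_. ()) T"
      by (intro linorder_inj_onI) auto
    have "(\<Sum>t. indicator T t :: ennreal) \<le> of_nat (card {()})"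
      by (rule suminf_indicator_le_card[OF _ _ inj]) auto
    then have le: "(\<Sum>t. indicator T t :: ennreal) \<le> 1" by simp
    have "(\<Sum>t. indicator (B t) (S (- int t) x) * f x) = (\<Sum>t. indicator T t * f x)"
      by (simp add: T_def indicator_def)
    also have "\<dots> = (\<Sum>t. indicator T t) * f x" by simp
    also have "\<dots> \<le> 1 * f x" using le by (rule mult_right_mono) simp
    finally show "(\<Sum>t. indicator (B t) (S (- int t) x) * f x) \<le> f x" by simp
  qed
  finally show ?thesis .
qed

text \<open>The classification changes with the level: step \<open>k\<close> returns to the class given by \<open>c k\<close>.\<close>

primrec iterated_return_time :: "(nat \<Rightarrow> 'b \<Rightarrow> 'c) \<Rightarrow> 'b \<Rightarrow> nat \<Rightarrow> enat" where
  "iterated_return_time c x 0 = 0"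
| "iterated_return_time c x (Suc k) =
     (case iterated_return_time c x k of
        enat z \<Rightarrow> enat z + return_time (c (Suc k)) (S (int z) x)
      | \<infinity> \<Rightarrow> \<infinity>)"

context
  fixes c :: "nat \<Rightarrow> 'b \<Rightarrow> 'c" and K :: "nat \<Rightarrow> 'c set"
  assumes fin: "\<And>k. finite (K k)"
    and K: "\<And>k x. x \<in> space N \<Longrightarrow> c k x \<in> K k"
    and c: "\<And>k a. Measurable.pred N (\<lambda>x. c k x = a)"
begin

lemma measurable_iterated_return_time [measurable]:
  "(\<lambda>x. iterated_return_time c x k) \<in> N \<rightarrow>\<^sub>M count_space UNIV"
proof (induction k)
  case (Suc k)
  note [measurable] = Suc measurable_return_time[OF fin K c]
  show ?case unfolding iterated_return_time.simps by measurable
qed simp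

text \<open>The mass bound for one step composes, since step \<open>k + 1\<close> starts from the point that the first
  \<open>k\<close> steps reach. It transfers Kac's inequality to each step, in the next lemma.\<close>

lemma nn_integral_at_iterated_return_time_le:
  assumes "f \<in> borel_measurable N"
  shows "(\<integral>\<^sup>+x. at_time (iterated_return_time c x k) f x \<partial>N) \<le> (\<integral>\<^sup>+x. f x \<partial>N)"
  using assms
proof (induction k arbitrary: f)
  case 0
  then show ?case by (simp add: at_time_def S_0 zero_enat_def)
next
  case (Suc k)
  note [measurable] = Suc.prems measurable_return_time[OF fin K c, of "Suc k"]
  have "at_time (iterated_return_time c x (Suc k)) f x =
      at_time (iterated_return_time c x k) (\<lambda>y. at_time (return_time (c (Suc k)) y) f y) x" for x
    by (auto simp: at_time_def S_add add.commute split: enat.split)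
  then have "(\<integral>\<^sup>+x. at_time (iterated_return_time c x (Suc k)) f x \<partial>N) \<le>
      (\<integral>\<^sup>+x. at_time (return_time (c (Suc k)) x) f x \<partial>N)"
    using Suc.IH[of "\<lambda>y. at_time (return_time (c (Suc k)) y) f y"] by simp
  also have "\<dots> \<le> (\<integral>\<^sup>+x. f x \<partial>N)"
    by (rule nn_integral_at_return_time_le[OF fin K c Suc.prems])
  finally show ?case .
qed

lemma nn_integral_iterated_return_time_le:
  "(\<integral>\<^sup>+x. ennreal_of_enat (iterated_return_time c x k) \<partial>N) \<le> of_nat (\<Sum>j=1..k. card (K j))"
proof (induction k)
  case (Suc k)
  note [measurable] = measurable_return_time[OF fin K c, of "Suc k"]
  let ?r = "\<lambda>x. ennreal_of_enat (return_time (c (Suc k)) x)"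
  have "ennreal_of_enat (iterated_return_time c x (Suc k)) =
      ennreal_of_enat (iterated_return_time c x k) + at_time (iterated_return_time c x k) ?r x" for x
    by (auto simp: at_time_def split: enat.split)
  then have "(\<integral>\<^sup>+x. ennreal_of_enat (iterated_return_time c x (Suc k)) \<partial>N) =
      (\<integral>\<^sup>+x. ennreal_of_enat (iterated_return_time c x k) \<partial>N) +
      (\<integral>\<^sup>+x. at_time (iterated_return_time c x k) ?r x \<partial>N)"
    by (simp add: nn_integral_add)
  also have "\<dots> \<le> of_nat (\<Sum>j=1..k. card (K j)) + of_nat (card (K (Suc k)))"
    using nn_integral_at_iterated_return_time_le[of ?r k] nn_integral_return_time_le[OF fin K c, of "Suc k"]
    by (intro add_mono Suc.IH) (auto intro: order_trans)
  finally show ?case by simp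
qed simp

text \<open>Markov's inequality and the Borel-Cantelli lemma.\<close>

lemma AE_eventually_iterated_return_time_less:
  fixes b :: "nat \<Rightarrow> real"
  assumes b: "\<And>k. b k > 0"
    and sum: "summable (\<lambda>k. real (\<Sum>j=1..k. card (K j)) / b k)"
  shows "AE x in N. \<forall>\<^sub>F k in sequentially. ennreal_of_enat (iterated_return_time c x k) < ennreal (b k)"
proof -
  define A where "A k = {x\<in>space N. ennreal (b k) \<le> ennreal_of_enat (iterated_return_time c x k)}" for k
  have [measurable]: "A k \<in> sets N" for k unfolding A_def by measurable
  have "measure N (A k) \<le> real (\<Sum>j=1..k. card (K j)) / b k" for k
  proof -
    let ?E = "\<Sum>j=1..k. card (K j)"
    have "ennreal (b k) * emeasure N (A k) = (\<integral>\<^sup>+x. ennreal (b k) * indicator (A k) x \<partial>N)"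
      by (simp add: nn_integral_cmult_indicator)
    also have "\<dots> \<le> (\<integral>\<^sup>+x. ennreal_of_enat (iterated_return_time c x k) \<partial>N)"
      by (intro nn_integral_mono) (auto simp: A_def indicator_def)
    also have "\<dots> \<le> ennreal (real ?E)"
      using nn_integral_iterated_return_time_le[of k] by (simp only: ennreal_of_nat_eq_real_of_nat)
    finally have "ennreal (b k * measure N (A k)) \<le> ennreal (real ?E)"
      using b[of k] by (simp add: emeasure_eq_measure ennreal_mult)
    then have "b k * measure N (A k) \<le> real ?E"
      by (rule iffD1[OF ennreal_le_iff[OF of_nat_0_le_iff]])
    then show ?thesis using b[of k] by (simp add: field_simps)
  qed
  then have "summable (\<lambda>k. measure N (A k))"
    by (intro summable_comparison_test'[OF sum, of 0]) simp
  then have "AE x in N. \<forall>\<^sub>F k in sequentially. x \<in> space N - A k"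
    by (intro borel_cantelli_AE1) (auto simp: emeasure_eq_measure)
  then show ?thesis
    by eventually_elim (auto simp: A_def not_le elim: eventually_mono)
qed

end

end

section \<open>The shift on the path space of a stationary process\<close>

definition path_shift :: "int \<Rightarrow> (int \<Rightarrow> real) \<Rightarrow> int \<Rightarrow> real" where
  "path_shift n x = (\<lambda>i. x (i + n))"

definition (in prob_space) path_law :: "(int \<Rightarrow> 'a \<Rightarrow> real) \<Rightarrow> (int \<Rightarrow> real) measure" where
  "path_law X = distr M (PiM UNIV (\<lambda>_. borel)) (\<lambda>\<omega> n. X n \<omega>)"

lemma measurable_path_shift [measurable]:
  "path_shift n \<in> PiM UNIV (\<lambda>_. borel) \<rightarrow>\<^sub>M PiM UNIV (\<lambda>_. borel)"
  unfolding path_shift_def by (rule measurable_PiM_single') (auto simp: space_PiM)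

lemma (in prob_space) measurable_path:
  assumes "stationary_process X"
  shows "(\<lambda>\<omega> n. X n \<omega>) \<in> M \<rightarrow>\<^sub>M PiM UNIV (\<lambda>_. borel)"
  using assms unfolding stationary_process_def by (intro measurable_PiM_single') (auto simp: space_PiM)

text \<open>Stationarity speaks of finitely many coordinates at a time; it extends to the law of the whole path
  because a finite measure on path space is determined by its values on finite-dimensional boxes.\<close>

lemma (in prob_space) measure_preserving_path_shift:
  assumes X: "stationary_process X"
  shows "measure_preserving_action (path_law X) path_shift"
proof -
  let ?\<Pi> = "PiM UNIV (\<lambda>_. borel) :: (int \<Rightarrow> real) measure"
  note path [measurable] = measurable_path[OF X]
  have rv [measurable]: "random_variable borel (X n)" for n
    using X unfolding stationary_process_def by auto
  have shifted [measurable]: "(\<lambda>\<omega> i. X (i + n) \<omega>) \<in> M \<rightarrow>\<^sub>M ?\<Pi>" for n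
    by (intro measurable_PiM_single') (auto simp: space_PiM)
  interpret L: prob_space "path_law X"
    unfolding path_law_def by (rule prob_space_distr[OF path])
  have invariant: "distr (path_law X) (path_law X) (path_shift n) = path_law X" for n
  proof -
    have "distr M ?\<Pi> (\<lambda>\<omega> i. X (i + n) \<omega>) = distr M ?\<Pi> (\<lambda>\<omega> i. X i \<omega>)"
    proof (rule measure_eqI_PiM_infinite)
      fix A :: "int \<Rightarrow> real set" and J :: "int set"
      assume J: "finite J" and A: "\<And>i. i \<in> J \<Longrightarrow> A i \<in> sets borel"
      have cyl [measurable]: "Pi\<^sub>E J A \<in> sets (PiM J (\<lambda>_. borel))"
        using J A by (intro sets_PiM_I_finite) auto
      have box: "emeasure (distr M ?\<Pi> Y) (prod_emb UNIV (\<lambda>_. borel) J (Pi\<^sub>E J A)) =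
          emeasure (distr M (PiM J (\<lambda>_. borel)) (\<lambda>\<omega>. restrict (Y \<omega>) J)) (Pi\<^sub>E J A)"
        if [measurable]: "Y \<in> M \<rightarrow>\<^sub>M ?\<Pi>" for Y
      proof -
        have r: "(\<lambda>x. restrict x J) \<in> ?\<Pi> \<rightarrow>\<^sub>M PiM J (\<lambda>_. borel)"
          by (rule measurable_restrict_subset) simp
        have [measurable]: "(\<lambda>\<omega>. restrict (Y \<omega>) J) \<in> M \<rightarrow>\<^sub>M PiM J (\<lambda>_. borel)"
          by (rule measurable_compose[OF that r])
        have "prod_emb UNIV (\<lambda>_. borel) J (Pi\<^sub>E J A) \<in> sets ?\<Pi>"
          by (rule measurable_prod_emb) (use cyl in auto)
        then show ?thesis
          by (simp add: emeasure_distr prod_emb_def space_PiM vimage_def Int_def)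
      qed
      have "distr M (PiM J (\<lambda>_. borel)) (\<lambda>\<omega>. \<lambda>i\<in>J. X (i + n) \<omega>) =
          distr M (PiM J (\<lambda>_. borel)) (\<lambda>\<omega>. \<lambda>i\<in>J. X i \<omega>)"
        using X J unfolding stationary_process_def by blast
      then show "emeasure (distr M ?\<Pi> (\<lambda>\<omega> i. X (i + n) \<omega>)) (prod_emb UNIV (\<lambda>_. borel) J (Pi\<^sub>E J A)) =
          emeasure (distr M ?\<Pi> (\<lambda>\<omega> i. X i \<omega>)) (prod_emb UNIV (\<lambda>_. borel) J (Pi\<^sub>E J A))"
        by (simp add: box)
    qed (auto intro!: prob_space.finite_measure prob_space_distr)
    moreover have "distr (path_law X) (path_law X) (path_shift n) = distr M ?\<Pi> (\<lambda>\<omega> i. X (i + n) \<omega>)"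
    proof -
      have "distr (path_law X) (path_law X) (path_shift n) = distr (path_law X) ?\<Pi> (path_shift n)"
        by (rule distr_cong) (simp_all add: path_law_def)
      also have "\<dots> = distr M ?\<Pi> (path_shift n \<circ> (\<lambda>\<omega> i. X i \<omega>))"
        unfolding path_law_def by (rule distr_distr) measurable
      also have "path_shift n \<circ> (\<lambda>\<omega> i. X i \<omega>) = (\<lambda>\<omega> i. X (i + n) \<omega>)"
        by (simp add: path_shift_def fun_eq_iff)
      finally show ?thesis .
    qed
    ultimately show ?thesis by (simp add: path_law_def)
  qed
  have "path_shift n \<in> path_law X \<rightarrow>\<^sub>M path_law X" for n
    by (simp add: path_law_def)
  then show ?thesis
    using invariant by unfold_locales (simp_all add: path_shift_def ac_simps)
qed

section \<open>Quantized blocks\<close>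

lemma cell_eq_iff:
  assumes "partition_on UNIV Q" "C \<in> Q"
  shows "cell Q x = C \<longleftrightarrow> x \<in> C"
proof -
  have "\<exists>!C. C \<in> Q \<and> x \<in> C"
    using assms(1) by (auto simp: partition_on_def disjoint_def)
  then show ?thesis
    unfolding cell_def using assms(2) by (metis (mono_tags, lifting) theI')
qed

lemma cell_in_partition:
  assumes "partition_on UNIV Q"
  shows "cell Q x \<in> Q"
proof -
  obtain C where "C \<in> Q" "x \<in> C"
    using assms by (auto simp: partition_on_def)
  then show ?thesis using cell_eq_iff[OF assms] by metis
qed

lemma pred_cell_eq:
  assumes "finite_interval_partition Q"
  shows "Measurable.pred borel (\<lambda>x. cell Q x = C)"
proof (cases "C \<in> Q")
  case True
  with assms have "C \<in> sets borel"
    unfolding finite_interval_partition_def by (intro real_interval_borel_measurable) auto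
  then show ?thesis
    using True assms by (simp add: cell_eq_iff finite_interval_partition_def pred_def)
next
  case False
  then have "cell Q x \<noteq> C" for x
    using assms cell_in_partition unfolding finite_interval_partition_def by blast
  then show ?thesis by simp
qed

lemma pred_quantized_block_eq:
  assumes "finite_interval_partition Q"
  shows "Measurable.pred (PiM UNIV (\<lambda>_. borel)) (\<lambda>x. quantized_block Q x m n = B)"
proof -
  have "Measurable.pred (PiM UNIV (\<lambda>_. borel)) (\<lambda>x. map (\<lambda>i. cell Q (x i)) is = B)" for "is" :: "int list"
  proof (induction "is" arbitrary: B)
    case (Cons i "is")
    show ?case
    proof (cases B)
      case (Cons C B')
      have "Measurable.pred (PiM UNIV (\<lambda>_. borel)) (\<lambda>x. cell Q (x i) = C)"
        by (rule measurable_compose[OF _ pred_cell_eq[OF assms]]) measurable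
      with Cons.IH[of B'] show ?thesis by (simp add: Cons)
    qed simp
  qed simp
  then show ?thesis unfolding quantized_block_def .
qed

lemma quantized_block_shift:
  "quantized_block Q (path_shift z x) m n = quantized_block Q x (m + z) (n + z)"
proof -
  have "[m + z..n + z] = map (\<lambda>i. i + z) [m..n]"
    by (rule nth_equalityI) auto
  then show ?thesis by (simp add: quantized_block_def path_shift_def)
qed

lemma card_mono_of_refines:
  assumes "refines UNIV P Q" "finite P"
  shows "card Q \<le> card P"
proof -
  have parts: "partition_on UNIV P" "partition_on UNIV Q"
    and sub: "\<forall>X\<in>P. \<exists>Y\<in>Q. X \<subseteq> Y"
    using assms(1) by (auto simp: refines_def)
  then obtain g where g: "\<And>X. X \<in> P \<Longrightarrow> g X \<in> Q \<and> X \<subseteq> g X"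
    by metis
  have "Q \<subseteq> g ` P"
  proof
    fix Y assume Y: "Y \<in> Q"
    then obtain x where x: "x \<in> Y"
      using parts(2) unfolding partition_on_def by (metis all_not_in_conv)
    obtain X where X: "X \<in> P" "x \<in> X"
      using parts(1) by (auto simp: partition_on_def)
    then have "g X = Y"
      using g[OF X(1)] Y x parts(2) unfolding partition_on_def disjoint_def by blast
    then show "Y \<in> g ` P" using X(1) by blast
  qed
  then show ?thesis by (rule surj_card_le[OF assms(2)])
qed

theorem theorem3:
  fixes M :: "'a measure"
    and X :: "int \<Rightarrow> 'a \<Rightarrow> real"
    and P :: "nat \<Rightarrow> real set set"
    and l :: "nat \<Rightarrow> nat"
    and \<epsilon> :: real
  assumes "prob_space M"
    and "prob_space.stationary_process M X"
    and "\<And>k. finite_interval_partition (P k)"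
    and "\<And>k. refines UNIV (P (Suc k)) (P k)"
    and "\<And>x. (\<lambda>k. ediam (cell (P k) x)) \<longlonglongrightarrow> 0"
    and "mono_on {1..} l"
    and "\<And>k. k \<ge> 1 \<Longrightarrow> 1 \<le> l k \<and> l k \<le> k"
    and "filterlim l at_top sequentially"
    and "\<epsilon> > 0"
    and "summable (\<lambda>j. let k = Suc j in (real k + 1) * 2 powr - (real (l k) * \<epsilon>))"
  shows "AE \<omega> in M. \<forall>\<^sub>F k in sequentially.
           ereal_of_enat (zeta P l (\<lambda>n. X n \<omega>) k)
             < ereal (real (card (P k) ^ l k) * 2 powr (real (l k) * \<epsilon>))"
proof -
  interpret prob_space M by fact
  interpret A: measure_preserving_action "path_law X" path_shift
    by (rule measure_preserving_path_shift) fact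
  define c where "c k x = quantized_block (P k) x (- (int (l k) - 1)) 0" for k x
  define K where "K k = {B. set B \<subseteq> P k \<and> length B = l k}" for k
  have part: "partition_on UNIV (P k)" and finP: "finite (P k)" for k
    using assms(3)[of k] by (auto simp: finite_interval_partition_def)
  have finK: "finite (K k)" for k
    unfolding K_def using finP by (rule finite_lists_length_eq)
  have cardK: "card (K k) = card (P k) ^ l k" for k
    unfolding K_def using finP by (rule card_lists_length_eq)
  have cK: "c k x \<in> K k" for k x
    using cell_in_partition[OF part[of k]] by (auto simp: c_def K_def quantized_block_def)
  have c_meas: "Measurable.pred (path_law X) (\<lambda>x. c k x = B)" for k B
    using pred_quantized_block_eq[OF assms(3)] by (simp add: c_def path_law_def)
  \<comment> \<open>The stopping times depend on the path only through shifts of it, as return times do.\<close>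
  have recur: "recurrence_time (P k) (l k) x z = A.return_time (c k) (path_shift z x)" for k x z
    by (simp add: recurrence_time_def A.return_time_def c_def quantized_block_shift A.S_add algebra_simps)
  have zeta: "zeta P l x k = A.iterated_return_time c x k" for x k
    by (induction k) (simp_all add: recur split: enat.split)
  have pos: "card (P k) > 0" for k
    using part[of k] finP[of k] by (auto simp: card_gt_0_iff partition_on_def)
  have mono_P: "card (P j) \<le> card (P k)" if "j \<le> k" for j k
    using that by (rule lift_Suc_mono_le[rotated]) (rule card_mono_of_refines[OF assms(4) finP])
  define b where "b k = real (card (P k) ^ l k) * 2 powr (real (l k) * \<epsilon>)" for k
  have b: "b k > 0" for k
    using pos by (simp add: b_def)
  \<comment> \<open>The block lengths are monotone only from level 1 on.\<close>
  have term_le: "real (\<Sum>j=1..k. card (K j)) / b k \<le> (real k + 1) * 2 powr - (real (l k) * \<epsilon>)"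
    if "k \<ge> 1" for k
  proof -
    have "card (K j) \<le> card (P k) ^ l k" if "j \<in> {1..k}" for j
    proof -
      have "l j \<le> l k" using that by (intro mono_onD[OF assms(6)]) auto
      then have "card (P k) ^ l j \<le> card (P k) ^ l k"
        using pos[of k] by (intro power_increasing) auto
      moreover have "card (P j) ^ l j \<le> card (P k) ^ l j"
        using that mono_P by (intro power_mono) auto
      ultimately show ?thesis by (simp add: cardK)
    qed
    then have "(\<Sum>j=1..k. card (K j)) \<le> k * card (P k) ^ l k"
      using sum_bounded_above[of "{1..k}" "\<lambda>j. card (K j)" "card (P k) ^ l k"] by simp
    then have "real (\<Sum>j=1..k. card (K j)) \<le> real (k * card (P k) ^ l k)"
      by (simp only: of_nat_le_iff)
    also have "\<dots> \<le> (real k + 1) * real (card (P k) ^ l k)"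
      by (simp add: algebra_simps)
    also have "\<dots> = (real k + 1) * 2 powr - (real (l k) * \<epsilon>) * b k"
      by (simp add: b_def powr_minus field_simps)
    finally show ?thesis using b[of k] by (simp add: pos_divide_le_eq)
  qed
  have less: "ereal_of_enat z < ereal (b k)" if "ennreal_of_enat z < ennreal (b k)" for z k
    using that by (cases z) (auto simp: ennreal_of_nat_eq_real_of_nat ennreal_less_iff)
  have "summable (\<lambda>j. real (\<Sum>i=1..Suc j. card (K i)) / b (Suc j))"
    using assms(10) unfolding Let_def
  proof (rule summable_comparison_test'[where N=0])
    fix j
    have "0 \<le> real (\<Sum>i=1..Suc j. card (K i)) / b (Suc j)"
      using b[of "Suc j"] by (intro divide_nonneg_pos of_nat_0_le_iff)
    then show "norm (real (\<Sum>i=1..Suc j. card (K i)) / b (Suc j)) \<le>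
        (real (Suc j) + 1) * 2 powr - (real (l (Suc j)) * \<epsilon>)"
      using term_le[of "Suc j"] unfolding real_norm_def by linarith
  qed
  then have "summable (\<lambda>k. real (\<Sum>j=1..k. card (K j)) / b k)"
    by (subst (asm) summable_Suc_iff)
  then have "AE x in path_law X. \<forall>\<^sub>F k in sequentially. ennreal_of_enat (zeta P l x k) < ennreal (b k)"
    unfolding zeta using finK cK c_meas b
    by (intro A.AE_eventually_iterated_return_time_less[where K=K]) auto
  then have "AE \<omega> in M. \<forall>\<^sub>F k in sequentially.
      ennreal_of_enat (zeta P l (\<lambda>n. X n \<omega>) k) < ennreal (b k)"
    unfolding path_law_def by (rule AE_distrD[OF measurable_path[OF assms(2)]])
  then show ?thesis
    unfolding b_def[symmetric] by eventually_elim (auto elim!: eventually_mono intro: less)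
qed

end
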